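(* Let $n\ge 6$. Among all cycle barbells $CB(k,a,b)$ (with integers $a,b\ge3$, $k\ge2$) having exactly $n$ vertices, the edge Kemeny's constant $\mathscr{K}_e$ is maximized by $CB(n-4,3,3)$, i.e. when $a=b=3$ and the path contains all remaining vertices. Moreover, \[ \mathscr{K}_e(CB(n-4,3,3))=\frac{2n^3+12n^2-51n+101}{6(n+1)}. \]
   Context: The cycle barbell $CB(k,a,b)$ is the graph obtained from a cycle $C_a$, a path $P_k$ on $k$ vertices and a cycle $C_b$ by identifying one endpoint of the path with a vertex of $C_a$ and the other endpoint with a vertex of $C_b$. It has $a+b+k-2$ vertices and $a+b+k-1$ edges. Kemeny's constant of an irreducible finite Markov chain with transition matrix $P$ whose eigenvalues (with multiplicity) are $1=\rho_1,\rho_2,\dots,\rho_N$ (with $1$ simple) is $\mathscr{K}(P)=\sum_{i=2}^{N}\frac{1}{1-\rho_i}$. $\mathscr{K}_e(G)$ is Kemeny's constant of the simple random walk on the arcs of $G$ (ordered pairs $(u,v)$ with $\{u,v\}$ an edge), where from $(u,v)$ one moves to $(v,w)$ with probability $1/\deg(v)$ for each neighbor $w$ of $v$. *)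

theory Defs
  imports "Jordan_Normal_Form.Char_Poly" "HOL-Library.Product_Lexorder"
begin

(* Kemeny's constant: sum over the eigenvalues rho (with multiplicity) different
   from 1 of 1/(1-rho).  Eigenvalues = roots of the characteristic polynomial over C,
   multiplicity = root order.  (Under the standing assumption that 1 is a simple
   eigenvalue, this is exactly sum_{i=2}^N 1/(1-rho_i).) *)
definition kemeny :: "complex mat \<Rightarrow> complex" where
  "kemeny P = (\<Sum>\<rho> \<in> {\<rho>. poly (char_poly P) \<rho> = 0} - {1}.
                 of_nat (order \<rho> (char_poly P)) / (1 - \<rho>))"

(* graph given by a vertex set V and a symmetric adjacency relation adj *)
definition gdeg :: "('a \<Rightarrow> 'a \<Rightarrow> bool) \<Rightarrow> 'a set \<Rightarrow> 'a \<Rightarrow> nat" where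
  "gdeg adj V v = card {w \<in> V. adj v w}"

definition arcs :: "('a \<Rightarrow> 'a \<Rightarrow> bool) \<Rightarrow> 'a set \<Rightarrow> ('a \<times> 'a) set" where
  "arcs adj V = {(u, v). u \<in> V \<and> v \<in> V \<and> adj u v}"

definition arc_walk_matrix :: "('a::linorder \<Rightarrow> 'a \<Rightarrow> bool) \<Rightarrow> 'a set \<Rightarrow> complex mat" where
  "arc_walk_matrix adj V =
    (let A = sorted_list_of_set (arcs adj V) in
     mat (length A) (length A)
       (\<lambda>(i, j). if snd (A ! i) = fst (A ! j)
                 then 1 / of_nat (gdeg adj V (snd (A ! i))) else 0))"

definition edge_kemeny :: "('a::linorder \<Rightarrow> 'a \<Rightarrow> bool) \<Rightarrow> 'a set \<Rightarrow> complex" where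
  "edge_kemeny adj V = kemeny (arc_walk_matrix adj V)"

(* Cycle barbell CB(k,a,b) on vertices {0..<a+b+k-2}:
   cycle C_a on 0..a-1; path P_k = p_0,...,p_(k-1) with p_0 = 0, p_j = a+j-1 (j>=1);
   cycle C_b on a+k-2 .. a+k+b-3 (so p_(k-1) = a+k-2 is on C_b). *)
definition cb_verts :: "nat \<Rightarrow> nat \<Rightarrow> nat \<Rightarrow> nat set" where
  "cb_verts k a b = {0..<a + b + k - 2}"

definition cb_pathv :: "nat \<Rightarrow> nat \<Rightarrow> nat" where
  "cb_pathv a j = (if j = 0 then 0 else a + j - 1)"

definition cb_edge :: "nat \<Rightarrow> nat \<Rightarrow> nat \<Rightarrow> nat \<Rightarrow> nat \<Rightarrow> bool" where
  "cb_edge k a b u v \<longleftrightarrow>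
     (\<exists>i<a. u = i \<and> v = (i + 1) mod a)
   \<or> (\<exists>j. j + 1 < k \<and> u = cb_pathv a j \<and> v = cb_pathv a (j + 1))
   \<or> (\<exists>i<b. u = a + k - 2 + i \<and> v = a + k - 2 + (i + 1) mod b)"

definition cb_adj :: "nat \<Rightarrow> nat \<Rightarrow> nat \<Rightarrow> nat \<Rightarrow> nat \<Rightarrow> bool" where
  "cb_adj k a b u v \<longleftrightarrow> cb_edge k a b u v \<or> cb_edge k a b v u"

definition Ke_CB :: "nat \<Rightarrow> nat \<Rightarrow> nat \<Rightarrow> complex" where
  "Ke_CB k a b = edge_kemeny (cb_adj k a b) (cb_verts k a b)"

end

theory Submission
  imports Defs "Jordan_Normal_Form.Schur_Decomposition"
begin

text \<open>
  Kemeny's constant is the trace of the fundamental matrix minus one. For the arc walk on a graph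
  with \<open>N\<close> arcs the fundamental matrix can be written down explicitly in terms of
  the effective resistances \<open>R\<close>, because the resistance from the head of one arc to the
  tail of another is almost inverted by the Laplacian of the arc walk. This gives
  \<open>N - |V| + (\<Sum>u v. d u * d v * R u v) / (2 * N)\<close>. On a cycle barbell \<open>R\<close>
  is the sum of a resistance on each cycle and a distance along the path, and with
  \<open>m = a + b + k - 1\<close> edges the double sum becomes
  \<open>(4 m^3 + 2 m)/3 - \<phi> a - \<phi> b\<close>, where \<open>\<phi> a = (8 m a^2 - 6 a^3 + 4 m)/3\<close>
  is smallest at \<open>a = 3\<close> over the admissible range.
\<close>

section \<open>Kemeny's constant and the fundamental matrix\<close>

lemma trace_mult_commute:
  fixes A B :: "'a :: comm_ring_1 mat"
  assumes "A \<in> carrier_mat n m" "B \<in> carrier_mat m n"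
  shows "(\<Sum>i<n. (A * B) $$ (i, i)) = (\<Sum>i<m. (B * A) $$ (i, i))"
proof -
  have "(\<Sum>i<n. (A * B) $$ (i, i)) = (\<Sum>i<n. \<Sum>j<m. A $$ (i, j) * B $$ (j, i))"
    using assms by (intro sum.cong) (auto simp: scalar_prod_def atLeast0LessThan)
  also have "\<dots> = (\<Sum>j<m. \<Sum>i<n. B $$ (j, i) * A $$ (i, j))"
    by (subst sum.swap) (simp add: mult.commute)
  also have "\<dots> = (\<Sum>i<m. (B * A) $$ (i, i))"
    using assms by (intro sum.cong) (auto simp: scalar_prod_def atLeast0LessThan)
  finally show ?thesis .
qed

text \<open>Schur triangularisation gives a similar matrix with the list \<open>es\<close> on its
  diagonal, and cyclicity of the trace removes the change of basis.\<close>

lemma trace_eq_sum_eigenvalues: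
  fixes A :: "complex mat"
  assumes A: "A \<in> carrier_mat n n" and es: "char_poly A = (\<Prod>e\<leftarrow>es. [:- e, 1:])"
  shows "(\<Sum>i<n. A $$ (i, i)) = sum_list es"
proof -
  obtain B P Q where "schur_decomposition A es = (B, P, Q)"
    by (cases "schur_decomposition A es") auto
  from schur_decomposition[OF A es this]
  have wit: "similar_mat_wit A B P Q" and diag: "diag_mat B = es" by auto
  from similar_mat_witD2[OF A wit]
  have QP: "Q * P = 1\<^sub>m n" and AB: "A = P * B * Q"
    and c: "B \<in> carrier_mat n n" "P \<in> carrier_mat n n" "Q \<in> carrier_mat n n" by auto
  have "(\<Sum>i<n. A $$ (i, i)) = (\<Sum>i<n. (Q * (P * B)) $$ (i, i))"
    unfolding AB using c by (intro trace_mult_commute) auto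
  also have "Q * (P * B) = B"
    using c QP by (metis assoc_mult_mat left_mult_one_mat)
  also have "(\<Sum>i<n. B $$ (i, i)) = sum_list es"
    using c by (simp add: diag[symmetric] diag_mat_def sum_list_distinct_conv_sum_set
        atLeast0LessThan)
  finally show ?thesis .
qed

lemma poly_char_poly_eq_det:
  fixes A :: "'a :: field mat"
  assumes "A \<in> carrier_mat n n"
  shows "poly (char_poly A) x = det (x \<cdot>\<^sub>m 1\<^sub>m n - A)"
proof -
  have "- char_matrix A x = x \<cdot>\<^sub>m 1\<^sub>m n - A"
    using assms by (intro eq_matI) (auto simp: char_matrix_def)
  then show ?thesis using char_poly_matrix[OF assms] by simp
qed

lemma poly_prod_linear: "poly (\<Prod>e\<leftarrow>es. [:- e, 1:]) x = (\<Prod>e\<leftarrow>es. x - (e :: 'a :: comm_ring_1))"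
  by (induction es) (auto simp: algebra_simps)

text \<open>For nonzero \<open>y\<close>, pulling out the scalar \<open>- y\<close> leaves the
  characteristic polynomial at \<open>- 1 / y\<close>; the \<open>n\<close> scalar factors are then
  distributed over the \<open>n\<close> linear factors.\<close>

lemma det_one_add_smult:
  fixes A :: "complex mat"
  assumes A: "A \<in> carrier_mat n n" and es: "char_poly A = (\<Prod>e\<leftarrow>es. [:- e, 1:])"
  shows "det (1\<^sub>m n + y \<cdot>\<^sub>m A) = (\<Prod>e\<leftarrow>es. 1 + y * e)"
proof (cases "y = 0")
  case True
  then have "1\<^sub>m n + y \<cdot>\<^sub>m A = 1\<^sub>m n" using A by (intro eq_matI) auto
  then show ?thesis using True by (simp add: map_replicate_const)
next
  case False
  have len: "length es = n"
    using degree_monic_char_poly[OF A] degree_linear_factors[of uminus es] es by simp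
  have "1\<^sub>m n + y \<cdot>\<^sub>m A = (- y) \<cdot>\<^sub>m ((- 1 / y) \<cdot>\<^sub>m 1\<^sub>m n - A)"
    using A False by (intro eq_matI) (auto simp: algebra_simps)
  then have "det (1\<^sub>m n + y \<cdot>\<^sub>m A) = (- y) ^ n * poly (char_poly A) (- 1 / y)"
    using A by (simp add: poly_char_poly_eq_det[OF A])
  also have "\<dots> = (- y) ^ length es * (\<Prod>e\<leftarrow>es. - 1 / y - e)"
    by (simp add: es poly_prod_linear len)
  also have "\<dots> = (\<Prod>e\<leftarrow>es. 1 + y * e)"
    using False by (induction es) (auto simp: field_simps)
  finally show ?thesis .
qed

text \<open>An idempotent has only the eigenvalues 0 and 1, so its trace counts the ones; trace one
  leaves exactly one of them.\<close>

lemma char_poly_idempotent_trace_one: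
  fixes W :: "complex mat"
  assumes W: "W \<in> carrier_mat n n" and idem: "W * W = W" and tr: "(\<Sum>i<n. W $$ (i, i)) = 1"
  shows "char_poly W = [:-1, 1:] * [:0, 1:] ^ (n - 1)"
proof -
  obtain es where es: "char_poly W = (\<Prod>e\<leftarrow>es. [:- e, 1:])" and len: "length es = n"
    using char_poly_factorized[OF W] by auto
  have ev: "e = 0 \<or> e = 1" if "e \<in> set es" for e
  proof -
    have "poly (char_poly W) e = 0"
      using that unfolding es poly_prod_linear by (auto simp: prod_list_zero_iff)
    then have "eigenvalue W e" using eigenvalue_root_char_poly[OF W] by simp
    then obtain v where v: "v \<in> carrier_vec n" "v \<noteq> 0\<^sub>v n" "W *\<^sub>v v = e \<cdot>\<^sub>v v"
      using W unfolding eigenvalue_def eigenvector_def by auto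
    have "e \<cdot>\<^sub>v v = (W * W) *\<^sub>v v" using v idem by simp
    also have "\<dots> = W *\<^sub>v (e \<cdot>\<^sub>v v)" using v W by (simp add: assoc_mult_mat_vec)
    also have "\<dots> = e \<cdot>\<^sub>v (e \<cdot>\<^sub>v v)" using v W by (simp add: mult_mat_vec)
    finally have eq: "e \<cdot>\<^sub>v v = e \<cdot>\<^sub>v (e \<cdot>\<^sub>v v)" .
    obtain i where i: "i < n" "v $ i \<noteq> 0"
      using v by (metis carrier_vecD eq_vecI index_zero_vec)
    have "e * v $ i = e * (e * v $ i)"
      using arg_cong[OF eq, of "\<lambda>w. w $ i"] i v by auto
    then show ?thesis using i by auto
  qed
  have "sum_list es = 1" using trace_eq_sum_eigenvalues[OF W es] tr by simp
  \<comment> \<open>The bound on \<open>c\<close> is carried through the induction so that the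
    natural subtraction in the exponent stays exact.\<close>
  moreover have "(\<Prod>e\<leftarrow>es. [:- e, 1:]) = [:-1, 1:] ^ c * [:0, 1:] ^ (length es - c)
      \<and> c \<le> length es \<and> sum_list es = of_nat c"
    if "c = length (filter (\<lambda>e. e = 1) es)" for c
    using ev that
  proof (induction es arbitrary: c)
    case (Cons e es)
    define c' where "c' = length (filter (\<lambda>e. e = 1) es)"
    have IH: "(\<Prod>e\<leftarrow>es. [:- e, 1:]) = [:-1, 1:] ^ c' * [:0, 1:] ^ (length es - c')"
      "c' \<le> length es" "sum_list es = of_nat c'" using Cons.IH[OF _ c'_def] Cons.prems(1) by auto
    have "e = 0 \<or> e = 1" using Cons.prems by auto
    then show ?case
    proof
      assume "e = 0"
      then show ?thesis using IH Cons.prems(2) c'_def[symmetric]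
        by (simp add: Suc_diff_le del: mult_pCons_left mult_pCons_right)
    next
      assume "e = 1"
      then show ?thesis using IH Cons.prems(2) c'_def[symmetric]
        by (simp add: mult.assoc del: mult_pCons_left mult_pCons_right)
    qed
  qed auto
  ultimately have "length (filter (\<lambda>e. e = 1) es) = 1" by (metis of_nat_eq_1_iff)
  then show ?thesis
    using \<open>\<And>c. c = _ \<Longrightarrow> _\<close>[OF refl] len es by simp
qed

section \<open>From root multiplicities to lists of eigenvalues\<close>

lemma order_prod_linear:
  "Polynomial.order (x :: complex) (\<Prod>r\<leftarrow>rs. [:- r, 1:]) = count_list rs x"
proof (induction rs)
  case (Cons r rs)
  have nz: "(\<Prod>r\<leftarrow>rs. [:- r, 1:]) \<noteq> (0 :: complex poly)"
    by (auto simp: prod_list_zero_iff)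
  then have "[:- r, 1:] * (\<Prod>r\<leftarrow>rs. [:- r, 1:]) \<noteq> 0" by (metis mult_eq_0_iff pCons_eq_0_iff one_neq_zero)
  then have "Polynomial.order x (\<Prod>r\<leftarrow>r # rs. [:- r, 1:]) = Polynomial.order x [:- r, 1:] + count_list rs x"
    using Cons.IH by (simp add: order_mult del: mult_pCons_left)
  also have "Polynomial.order x [:- r, 1:] = (if r = x then 1 else 0)"
    by (simp add: order_linear')
  finally show ?case by simp
qed auto

lemma sum_count_list_mult:
  fixes f :: "'a \<Rightarrow> 'b :: semiring_1"
  assumes "finite S" "set xs \<subseteq> S"
  shows "(\<Sum>x\<in>S. of_nat (count_list xs x) * f x) = (\<Sum>x\<leftarrow>xs. f x)"
  using assms(2)
proof (induction xs)
  case (Cons y xs)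
  have "(\<Sum>x\<in>S. of_nat (count_list (y # xs) x) * f x)
      = (\<Sum>x\<in>S. (if x = y then f x else 0) + of_nat (count_list xs x) * f x)"
    by (intro sum.cong) (auto simp: algebra_simps)
  also have "\<dots> = f y + (\<Sum>x\<in>S. of_nat (count_list xs x) * f x)"
    using Cons.prems assms(1) by (simp add: sum.distrib)
  finally show ?case using Cons by simp
qed simp

text \<open>The condition on \<open>rs\<close> says that 1 is a simple eigenvalue, so discarding the
  root 1 discards exactly the split-off factor. Root orders become multiplicities in the
  list.\<close>

lemma kemeny_eq_sum_list:
  assumes cp: "char_poly P = [:-1, 1:] * (\<Prod>r\<leftarrow>rs. [:- r, 1:])" and ne: "1 \<notin> set rs"
  shows "kemeny P = (\<Sum>r\<leftarrow>rs. 1 / (1 - r))"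
proof -
  have cp': "char_poly P = (\<Prod>r\<leftarrow>1 # rs. [:- r, 1:])" by (simp add: cp)
  have roots: "{\<rho>. poly (char_poly P) \<rho> = 0} - {1} = set rs"
    using ne unfolding cp' poly_prod_linear by (auto simp: prod_list_zero_iff)
  have "kemeny P = (\<Sum>\<rho>\<in>set rs. of_nat (count_list rs \<rho>) / (1 - \<rho>))"
    unfolding kemeny_def roots unfolding cp' order_prod_linear using ne
    by (intro sum.cong) auto
  also have "\<dots> = (\<Sum>r\<leftarrow>rs. 1 / (1 - r))"
    using sum_count_list_mult[of "set rs" rs "\<lambda>r. 1 / (1 - r)"] by simp
  finally show ?thesis .
qed

lemma poly_eq_if_eq_off_finite:
  fixes p q :: "'a :: {idom, ring_char_0} poly"
  assumes "finite S" "\<And>x. x \<notin> S \<Longrightarrow> poly p x = poly q x"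
  shows "p = q"
proof (rule ccontr)
  assume "p \<noteq> q"
  then have "finite {x. poly (p - q) x = 0}" by (intro poly_roots_finite) auto
  moreover have "UNIV \<subseteq> S \<union> {x. poly (p - q) x = 0}" using assms(2) by auto
  ultimately have "finite (UNIV :: 'a set)" using assms(1) by (meson finite_UnI finite_subset)
  then show False by (simp add: infinite_UNIV_char_0)
qed

text \<open>Since \<open>P W = W\<close>, adding \<open>W\<close> to \<open>1 - P\<close> only moves the eigenvalue
  \<open>0\<close> to \<open>1\<close>; on the level of determinants this is
  \<open>((1 + y) 1 - P) (y 1 + W) = y (y 1 + M)\<close> with \<open>M = 1 - P + W\<close>.\<close>

lemma kemeny_eq_trace_fundamental_matrix:
  fixes P \<Gamma> :: "complex mat" and n :: nat
  defines "W \<equiv> mat n n (\<lambda>_. 1 / of_nat n)"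
  assumes P: "P \<in> carrier_mat n n" and \<Gamma>: "\<Gamma> \<in> carrier_mat n n" and n: "n > 0"
    and rows: "\<And>i. i < n \<Longrightarrow> (\<Sum>j<n. P $$ (i, j)) = 1"
    and inv: "(1\<^sub>m n - P + W) * \<Gamma> = 1\<^sub>m n"
  shows "kemeny P = (\<Sum>i<n. \<Gamma> $$ (i, i)) - 1"
proof -
  have W: "W \<in> carrier_mat n n" by (simp add: W_def)
  have WW: "W * W = W"
    using n by (intro eq_matI) (auto simp: W_def scalar_prod_def)
  have PW: "P * W = W"
  proof (intro eq_matI)
    fix i j assume "i < dim_row W" "j < dim_col W"
    then have ij: "i < n" "j < n" by (auto simp: W_def)
    then have "(P * W) $$ (i, j) = (\<Sum>k<n. P $$ (i, k)) * (1 / of_nat n)"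
      using P by (simp add: W_def scalar_prod_def atLeast0LessThan sum_divide_distrib)
    then show "(P * W) $$ (i, j) = W $$ (i, j)" using ij rows by (simp add: W_def)
  qed (use P in \<open>auto simp: W_def\<close>)
  have trW: "(\<Sum>i<n. W $$ (i, i)) = 1" using n by (simp add: W_def)
  define M where "M = 1\<^sub>m n - P + W"
  have M: "M \<in> carrier_mat n n" unfolding M_def using P W by auto
  obtain es where es: "char_poly \<Gamma> = (\<Prod>e\<leftarrow>es. [:- e, 1:])"
    using char_poly_factorized[OF \<Gamma>] by auto
  have "det M * det \<Gamma> = 1" using inv det_mult[OF M \<Gamma>] by (simp add: M_def)
  then have det\<Gamma>: "det \<Gamma> \<noteq> 0" by auto
  \<comment> \<open>Up to the sign of each row this is the characteristic polynomial of
    \<open>W\<close> at \<open>- y\<close>, which is known since \<open>W\<close> is idempotent of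
    trace one.\<close>
  have detW: "det (y \<cdot>\<^sub>m 1\<^sub>m n + W) = y ^ (n - 1) * (y + 1)" for y
  proof -
    have "(-1) \<cdot>\<^sub>m (y \<cdot>\<^sub>m 1\<^sub>m n + W) = (- y) \<cdot>\<^sub>m 1\<^sub>m n - W"
      using W by (intro eq_matI) auto
    then have "poly (char_poly W) (- y) = det ((-1) \<cdot>\<^sub>m (y \<cdot>\<^sub>m 1\<^sub>m n + W))"
      by (simp only: poly_char_poly_eq_det[OF W])
    then have "(-1) ^ n * det (y \<cdot>\<^sub>m 1\<^sub>m n + W) = poly (char_poly W) (- y)"
      using W by simp
    also have "\<dots> = (- y - 1) * (- y) ^ (n - 1)"
      unfolding char_poly_idempotent_trace_one[OF W WW trW] by (simp add: algebra_simps)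
    also have "\<dots> = (-1) ^ Suc (n - 1) * (y ^ (n - 1) * (y + 1))"
      by (simp add: power_minus[of y] algebra_simps)
    finally show ?thesis using n by simp
  qed
  \<comment> \<open>\<open>eq2\<close> relates \<open>P\<close> to \<open>M\<close> and
    \<open>eq1\<close> relates \<open>M\<close> to \<open>\<Gamma>\<close>. Taking determinants and
    cancelling \<open>y ^ (n - 1)\<close>, which requires \<open>y\<close> nonzero, links the two
    spectra.\<close>
  have key: "(1 + y) * poly (char_poly P) (1 + y) * det \<Gamma> = y * (\<Prod>e\<leftarrow>es. 1 + y * e)"
    if y: "y \<noteq> 0" for y
  proof -
    have eq1: "(y \<cdot>\<^sub>m 1\<^sub>m n + M) * \<Gamma> = 1\<^sub>m n + y \<cdot>\<^sub>m \<Gamma>"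
    proof -
      have "(y \<cdot>\<^sub>m 1\<^sub>m n + M) * \<Gamma> = (y \<cdot>\<^sub>m 1\<^sub>m n) * \<Gamma> + M * \<Gamma>"
        using M \<Gamma> by (intro add_mult_distrib_mat) auto
      also have "(y \<cdot>\<^sub>m 1\<^sub>m n) * \<Gamma> = y \<cdot>\<^sub>m \<Gamma>"
        using \<Gamma> mult_smult_assoc_mat[of "1\<^sub>m n" n n \<Gamma> n y] by simp
      finally show ?thesis using inv \<Gamma> by (simp add: M_def comm_add_mat[of _ n n])
    qed
    have eq2: "((1 + y) \<cdot>\<^sub>m 1\<^sub>m n - P) * (y \<cdot>\<^sub>m 1\<^sub>m n + W) = y \<cdot>\<^sub>m (y \<cdot>\<^sub>m 1\<^sub>m n + M)"
    proof -
      let ?L = "(1 + y) \<cdot>\<^sub>m 1\<^sub>m n - P"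
      have L: "?L \<in> carrier_mat n n" using P by auto
      have "?L * (y \<cdot>\<^sub>m 1\<^sub>m n + W) = ?L * (y \<cdot>\<^sub>m 1\<^sub>m n) + ?L * W"
        using L W by (intro mult_add_distrib_mat) auto
      also have "?L * (y \<cdot>\<^sub>m 1\<^sub>m n) = y \<cdot>\<^sub>m ?L"
        using mult_smult_distrib[OF L, of "1\<^sub>m n" n y] right_mult_one_mat[OF L] by simp
      also have "?L * W = ((1 + y) \<cdot>\<^sub>m 1\<^sub>m n) * W - P * W"
        using P W by (intro minus_mult_distrib_mat) auto
      also have "((1 + y) \<cdot>\<^sub>m 1\<^sub>m n) * W = (1 + y) \<cdot>\<^sub>m W"
        using W mult_smult_assoc_mat[of "1\<^sub>m n" n n W n "1 + y"] by simp
      also have "y \<cdot>\<^sub>m ?L + ((1 + y) \<cdot>\<^sub>m W - P * W) = y \<cdot>\<^sub>m (y \<cdot>\<^sub>m 1\<^sub>m n + M)"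
        unfolding PW M_def using P W by (intro eq_matI) (auto simp: algebra_simps)
      finally show ?thesis .
    qed
    have d1: "det (y \<cdot>\<^sub>m 1\<^sub>m n + M) * det \<Gamma> = (\<Prod>e\<leftarrow>es. 1 + y * e)"
      using det_mult[of "y \<cdot>\<^sub>m 1\<^sub>m n + M" n \<Gamma>] M \<Gamma> det_one_add_smult[OF \<Gamma> es, of y]
      by (simp add: eq1)
    have "det ((1 + y) \<cdot>\<^sub>m 1\<^sub>m n - P) * det (y \<cdot>\<^sub>m 1\<^sub>m n + W)
        = y ^ n * det (y \<cdot>\<^sub>m 1\<^sub>m n + M)"
      using det_mult[OF minus_carrier_mat[OF P], of "y \<cdot>\<^sub>m 1\<^sub>m n + W" "(1 + y) \<cdot>\<^sub>m 1\<^sub>m n"] W M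
      by (simp add: eq2)
    then have "y ^ (n - 1) * (poly (char_poly P) (1 + y) * (1 + y))
        = y ^ (n - 1) * (y * det (y \<cdot>\<^sub>m 1\<^sub>m n + M))"
      unfolding detW poly_char_poly_eq_det[OF P] using n
      by (cases n) (auto simp: algebra_simps)
    then have "poly (char_poly P) (1 + y) * (1 + y) = y * det (y \<cdot>\<^sub>m 1\<^sub>m n + M)"
      using y by simp
    then show ?thesis using d1 by (metis mult.assoc mult.commute)
  qed
  \<comment> \<open>At \<open>y = -1\<close> the factor \<open>1 + y\<close> vanishes, so 1 is an
    eigenvalue of \<open>\<Gamma>\<close>; one copy of it is set aside as the partner of the
    eigenvalue 1 of \<open>P\<close>.\<close>
  have "(\<Prod>e\<leftarrow>es. 1 - e) = 0" using key[of "-1"] by simp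
  then have one: "1 \<in> set es" by (auto simp: prod_list_zero_iff)
  define fs where "fs = remove1 1 es"
  have perm: "mset es = mset (1 # fs)" using one by (simp add: fs_def)
  have prod_es: "(\<Prod>e\<leftarrow>es. f e) = f 1 * (\<Prod>e\<leftarrow>fs. f e)" for f :: "complex \<Rightarrow> complex"
    using arg_cong[OF perm, of "\<lambda>m. prod_mset (image_mset f m)"]
    by (simp add: prod_mset_prod_list flip: mset_map)
  have sum_es: "sum_list es = 1 + sum_list fs"
    using arg_cong[OF perm, of sum_mset] by (simp add: sum_mset_sum_list)
  have "poly (char_poly \<Gamma>) 0 \<noteq> 0"
  proof -
    have "0 \<cdot>\<^sub>m 1\<^sub>m n - \<Gamma> = (-1) \<cdot>\<^sub>m \<Gamma>" using \<Gamma> by (intro eq_matI) auto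
    then show ?thesis using det\<Gamma> by (simp add: poly_char_poly_eq_det[OF \<Gamma>])
  qed
  then have "0 \<notin> set es" unfolding es poly_prod_linear by (auto simp: prod_list_zero_iff)
  then have fs0: "0 \<notin> set fs" unfolding fs_def by (meson notin_set_remove1)
  \<comment> \<open>An eigenvalue \<open>e\<close> of \<open>\<Gamma>\<close> stands for the
    eigenvalue \<open>r = 1 - 1 / e\<close> of \<open>P\<close>, so that
    \<open>1 / (1 - r) = e\<close> and Kemeny's sum becomes a sum of eigenvalues of
    \<open>\<Gamma>\<close>.\<close>
  define rs where "rs = map (\<lambda>e. 1 - 1 / e) fs"
  define Q where "Q = [:-1, 1:] * (\<Prod>r\<leftarrow>rs. [:- r, 1 :: complex:])"
  have lin: "(\<Prod>e\<leftarrow>fs. 1 + (x - 1) * e) = prod_list fs * (\<Prod>r\<leftarrow>rs. x - r)" for x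
    using fs0 unfolding rs_def by (induction fs) (auto simp: field_simps)
  have smult: "Polynomial.smult (det \<Gamma>) (char_poly P) = Polynomial.smult (prod_list fs) Q"
  \<comment> \<open>With \<open>x = 1 + y\<close>, the point 1 is excluded because
    \<open>key\<close> needs \<open>y\<close> nonzero, and 0 because the factor \<open>x\<close> has
    to be cancelled.\<close>
  proof (rule poly_eq_if_eq_off_finite[of "{0, 1}"])
    fix x :: complex assume x: "x \<notin> {0, 1}"
    have "x * (poly (char_poly P) x * det \<Gamma>) = x * ((x - 1) * (\<Prod>e\<leftarrow>fs. 1 + (x - 1) * e))"
      using key[of "x - 1"] x by (simp add: prod_es algebra_simps)
    then have "poly (char_poly P) x * det \<Gamma> = (x - 1) * (\<Prod>e\<leftarrow>fs. 1 + (x - 1) * e)"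
      using x by simp
    then show "poly (Polynomial.smult (det \<Gamma>) (char_poly P)) x = poly (Polynomial.smult (prod_list fs) Q) x"
      unfolding lin Q_def by (simp add: poly_prod_linear algebra_simps)
  qed simp
  have monQ: "lead_coeff Q = 1"
  proof -
    have "lead_coeff (\<Prod>r\<leftarrow>rs. [:- r, 1 :: complex:]) = 1" by (intro monic_prod_list) auto
    then show ?thesis unfolding Q_def lead_coeff_mult by simp
  qed
  have monP: "lead_coeff (char_poly P) = 1" using degree_monic_char_poly[OF P] by simp
  \<comment> \<open>Both polynomials are monic, so comparing leading coefficients identifies the two
    scalars.\<close>
  have "det \<Gamma> = prod_list fs"
    using arg_cong[OF smult, of lead_coeff] monP monQ det\<Gamma> fs0 by simp
  then have "char_poly P = Q" using smult det\<Gamma> by (metis smult_cancel)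
  moreover have "1 \<notin> set rs" using fs0 by (auto simp: rs_def)
  ultimately have "kemeny P = (\<Sum>r\<leftarrow>rs. 1 / (1 - r))"
    unfolding Q_def by (rule kemeny_eq_sum_list)
  also have "\<dots> = sum_list fs" unfolding rs_def by (simp add: o_def)
  also have "\<dots> = (\<Sum>i<n. \<Gamma> $$ (i, i)) - 1"
    using trace_eq_sum_eigenvalues[OF \<Gamma> es] sum_es by simp
  finally show ?thesis .
qed

section \<open>The arc walk and effective resistances\<close>

lemma arcs_eq_Sigma: "arcs adj V = Sigma V (\<lambda>u. {w \<in> V. adj u w})"
  by (auto simp: arcs_def)

lemma sum_arcs:
  assumes "finite V"
  shows "(\<Sum>e\<in>arcs adj V. f e) = (\<Sum>u\<in>V. \<Sum>w | w \<in> V \<and> adj u w. f (u, w))"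
  unfolding arcs_eq_Sigma using assms by (subst sum.Sigma) auto

lemma sum_arcs_fst:
  fixes f :: "'a \<Rightarrow> real"
  assumes "finite V"
  shows "(\<Sum>e\<in>arcs adj V. f (fst e)) = (\<Sum>u\<in>V. real (gdeg adj V u) * f u)"
  using assms by (simp add: sum_arcs gdeg_def)

text \<open>Reversing arcs is a bijection by symmetry, so heads and tails are equally
  distributed.\<close>

lemma sum_arcs_snd:
  fixes f :: "'a \<Rightarrow> real"
  assumes "finite V" and sym: "\<And>u v. adj u v \<longleftrightarrow> adj v u"
  shows "(\<Sum>e\<in>arcs adj V. f (snd e)) = (\<Sum>u\<in>V. real (gdeg adj V u) * f u)"
proof -
  have "(\<Sum>e\<in>arcs adj V. f (snd e)) = (\<Sum>e\<in>arcs adj V. f (fst e))"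
    by (rule sum.reindex_bij_witness[of _ "\<lambda>(u, v). (v, u)" "\<lambda>(u, v). (v, u)"])
      (auto simp: arcs_def sym)
  then show ?thesis using sum_arcs_fst[OF assms(1)] by simp
qed

text \<open>The hypothesis \<open>lap\<close> is the identity satisfied by the effective resistances of the
  graph with unit conductances. The matrix \<open>\<gamma>\<close> in the proof is the fundamental matrix of
  the arc walk: up to centring it is the identity minus half the resistance from the head of one
  arc to the tail of the other.\<close>

lemma edge_kemeny_eq_resistance_sum:
  fixes V :: "'a :: linorder set" and adj :: "'a \<Rightarrow> 'a \<Rightarrow> bool" and R :: "'a \<Rightarrow> 'a \<Rightarrow> real"
  defines "d \<equiv> \<lambda>v. real (gdeg adj V v)"
  defines "N \<equiv> \<Sum>v\<in>V. d v"
  assumes fin: "finite V" and ne: "V \<noteq> {}"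
    and sym: "\<And>u v. adj u v \<longleftrightarrow> adj v u"
    and pos: "\<And>v. v \<in> V \<Longrightarrow> gdeg adj V v > 0"
    and diag: "\<And>v. v \<in> V \<Longrightarrow> R v v = 0"
    and lap: "\<And>v x. v \<in> V \<Longrightarrow> x \<in> V \<Longrightarrow>
      d v * R v x - (\<Sum>w | w \<in> V \<and> adj v w. R w x) = c v - (if v = x then 2 else 0)"
  shows "edge_kemeny adj V
    = of_real (N - real (card V) + (\<Sum>u\<in>V. \<Sum>v\<in>V. d u * d v * R u v) / (2 * N))"
proof -
  define E where "E = arcs adj V"
  have finE: "finite E" unfolding E_def arcs_eq_Sigma using fin by auto
  have cardE: "real (card E) = N"
    using sum_arcs_fst[OF fin, of "\<lambda>_. 1" adj] by (simp add: E_def N_def d_def)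
  have dpos: "d v > 0" if "v \<in> V" for v using pos[OF that] by (simp add: d_def)
  have Npos: "N > 0" unfolding N_def using fin ne dpos by (intro sum_pos) auto
  have inV: "fst e \<in> V" "snd e \<in> V" if "e \<in> E" for e
    using that by (auto simp: E_def arcs_def)

  define p where "p e f = (if snd e = fst f then 1 / d (snd e) else 0)" for e f :: "'a \<times> 'a"
  define r where "r v = (\<Sum>f\<in>E. R v (fst f))" for v
  define s where "s x = (\<Sum>e\<in>E. R (snd e) x)" for x
  define S where "S = (\<Sum>e\<in>E. r (snd e))"
  \<comment> \<open>\<open>r\<close> and \<open>s\<close> are the row and column sums of the matrix
    of head-to-tail resistances and \<open>S\<close> is its total. Thus half of that matrix is
    doubly centred before being subtracted from the identity.\<close>
  define \<gamma> where "\<gamma> e f = (if e = f then 1 else 0) - R (snd e) (fst f) / 2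
      + r (snd e) / (2 * N) + s (fst f) / (2 * N) - S / (2 * N\<^sup>2)" for e f :: "'a \<times> 'a"
  define nb where "nb v = {w \<in> V. adj v w}" for v
  have card_nb: "real (card (nb v)) = d v" for v by (simp add: nb_def d_def gdeg_def)

  have p_sum: "(\<Sum>g\<in>E. p e g * h g) = (\<Sum>w\<in>nb (snd e). h (snd e, w)) / d (snd e)"
    if e: "e \<in> E" for e and h :: "'a \<times> 'a \<Rightarrow> real"
  proof -
    have "(\<Sum>g\<in>E. p e g * h g) = (\<Sum>u\<in>V. \<Sum>w\<in>nb u. p e (u, w) * h (u, w))"
      unfolding E_def sum_arcs[OF fin] by (simp add: nb_def)
    also have "\<dots> = (\<Sum>u\<in>V. if u = snd e then (\<Sum>w\<in>nb u. h (u, w)) / d u else 0)"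
      by (intro sum.cong) (auto simp: p_def sum_divide_distrib)
    finally show ?thesis using inV[OF e] fin by simp
  qed
  have p_row: "(\<Sum>g\<in>E. p e g) = 1" if "e \<in> E" for e
    using p_sum[OF that, of "\<lambda>_. 1"] card_nb dpos[OF inV(2)[OF that]] by simp

  \<comment> \<open>Dividing \<open>lap\<close> by the degree turns its point mass into
    \<open>2 * p e f\<close>, since \<open>p e f\<close> is the indicator of
    \<open>snd e = fst f\<close> over the degree of \<open>snd e\<close>.\<close>
  have avg: "R (snd e) (fst f) - (\<Sum>w\<in>nb (snd e). R w (fst f)) / d (snd e)
      = c (snd e) / d (snd e) - 2 * p e f" if "e \<in> E" "f \<in> E" for e f
    using lap[OF inV(2)[OF that(1)] inV(1)[OF that(2)]] dpos[OF inV(2)[OF that(1)]]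
    unfolding nb_def p_def by (auto simp: field_simps)
  have avg_r: "r (snd e) - (\<Sum>w\<in>nb (snd e). r w) / d (snd e)
      = N * (c (snd e) / d (snd e)) - 2" if e: "e \<in> E" for e
  proof -
    have "r (snd e) - (\<Sum>w\<in>nb (snd e). r w) / d (snd e)
        = (\<Sum>f\<in>E. R (snd e) (fst f) - (\<Sum>w\<in>nb (snd e). R w (fst f)) / d (snd e))"
      unfolding r_def by (subst sum.swap) (simp add: sum_subtractf sum_divide_distrib)
    also have "\<dots> = (\<Sum>f\<in>E. c (snd e) / d (snd e) - 2 * p e f)"
      using avg[OF e] by (intro sum.cong) auto
    also have "\<dots> = N * (c (snd e) / d (snd e)) - 2 * (\<Sum>f\<in>E. p e f)"
      by (simp add: sum_subtractf sum_distrib_left cardE)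
    finally show ?thesis using p_row[OF e] by simp
  qed

  have \<gamma>_col: "(\<Sum>g\<in>E. \<gamma> g f) = 1" if f: "f \<in> E" for f
  proof -
    have "(\<Sum>g\<in>E. \<gamma> g f) = 1 - s (fst f) / 2 + S / (2 * N) + N * (s (fst f) / (2 * N))
        - N * (S / (2 * N\<^sup>2))"
      unfolding \<gamma>_def using f finE
      by (simp add: sum.distrib sum_subtractf cardE flip: sum_divide_distrib s_def S_def)
    then show ?thesis using Npos by (simp add: field_simps power2_eq_square)
  qed
  \<comment> \<open>Applying identity minus \<open>p\<close>: the identity part of
    \<open>\<gamma>\<close> leaves \<open>- p e f\<close>, which the resistance part cancels by
    \<open>avg\<close>. The curvature terms cancel between \<open>R\<close> and \<open>r\<close>,
    where the \<open>- 2\<close> in \<open>avg_r\<close> leaves \<open>- 1 / N\<close>. The part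
    \<open>q\<close> does not depend on \<open>e\<close> and is annihilated because rows of
    \<open>p\<close> sum to one.\<close>
  have \<gamma>_p: "\<gamma> e f - (\<Sum>g\<in>E. p e g * \<gamma> g f) = (if e = f then 1 else 0) - 1 / N"
    if e: "e \<in> E" and f: "f \<in> E" for e f
  proof -
    define D where "D = d (snd e)"
    have D: "D > 0" using dpos inV e by (simp add: D_def)
    define X where "X = (\<Sum>w\<in>nb (snd e). R w (fst f)) / D"
    define Y where "Y = (\<Sum>w\<in>nb (snd e). r w) / D"
    define q where "q = s (fst f) / (2 * N) - S / (2 * N\<^sup>2)"
    have "(\<Sum>g\<in>E. p e g * \<gamma> g f)
        = (\<Sum>g\<in>E. p e g * (if g = f then 1 else 0)) - (\<Sum>g\<in>E. p e g * (R (snd g) (fst f))) / 2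
          + (\<Sum>g\<in>E. p e g * r (snd g)) / (2 * N) + (\<Sum>g\<in>E. p e g) * q"
      unfolding \<gamma>_def q_def sum_divide_distrib sum_distrib_right
      unfolding sum_subtractf[symmetric] sum.distrib[symmetric]
      by (intro sum.cong) (auto simp: algebra_simps)
    also have "(\<Sum>g\<in>E. p e g * (if g = f then 1 else 0)) = p e f"
      using f finE by (simp add: if_distrib cong: if_cong)
    finally have "(\<Sum>g\<in>E. p e g * \<gamma> g f) = p e f - X / 2 + Y / (2 * N) + q"
      using p_row[OF e] by (simp add: p_sum[OF e] X_def Y_def D_def)
    moreover have "\<gamma> e f = (if e = f then 1 else 0) - R (snd e) (fst f) / 2 + r (snd e) / (2 * N) + q"
      by (simp add: \<gamma>_def q_def)
    moreover have "R (snd e) (fst f) = X + c (snd e) / D - 2 * p e f"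
      using avg[OF e f] by (simp add: X_def D_def)
    moreover have "r (snd e) = Y + N * (c (snd e) / D) - 2"
      using avg_r[OF e] by (simp add: Y_def D_def)
    ultimately show ?thesis using Npos by (simp add: field_simps)
  qed
  \<comment> \<open>The columns of \<open>\<gamma>\<close> sum to one, so the averaging term
    contributes exactly the missing \<open>1 / N\<close>.\<close>
  have \<gamma>_inv: "(\<Sum>g\<in>E. ((if e = g then 1 else 0) - p e g + 1 / N) * \<gamma> g f) = (if e = f then 1 else 0)"
    if e: "e \<in> E" and f: "f \<in> E" for e f
  proof -
    have "(\<Sum>g\<in>E. ((if e = g then 1 else 0) - p e g + 1 / N) * \<gamma> g f)
        = (\<Sum>g\<in>E. (if e = g then \<gamma> g f else 0)) - (\<Sum>g\<in>E. p e g * \<gamma> g f) + (\<Sum>g\<in>E. \<gamma> g f) / N"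
      unfolding sum_divide_distrib sum_subtractf[symmetric] sum.distrib[symmetric]
      by (intro sum.cong) (auto simp: algebra_simps)
    also have "\<dots> = \<gamma> e f - (\<Sum>g\<in>E. p e g * \<gamma> g f) + 1 / N"
      using e finE \<gamma>_col[OF f] by simp
    finally show ?thesis using \<gamma>_p[OF e f] by simp
  qed

  \<comment> \<open>Summing \<open>lap\<close> over \<open>v\<close> for fixed \<open>x\<close>
    makes its left side telescope to zero, leaving only the point mass 2.\<close>
  have sum_c: "(\<Sum>v\<in>V. c v) = 2"
  proof -
    obtain x where x: "x \<in> V" using ne by auto
    have "(\<Sum>v\<in>V. \<Sum>w | w \<in> V \<and> adj v w. R w x) = (\<Sum>v\<in>V. d v * R v x)"
      using sum_arcs_snd[OF fin sym, of "\<lambda>w. R w x"] by (simp add: sum_arcs[OF fin] d_def)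
    then have "(\<Sum>v\<in>V. c v - (if v = x then 2 else 0)) = 0"
      using lap[OF _ x] by (simp add: sum_subtractf flip: lap[OF _ x])
    then show ?thesis using x fin by (simp add: sum_subtractf)
  qed
  \<comment> \<open>This is Foster's theorem: resistances across edges add up to the number of
    vertices minus one, and each edge gives two arcs. It follows from \<open>lap\<close> on the
    diagonal together with \<open>sum_c\<close>.\<close>
  have foster: "(\<Sum>e\<in>E. R (snd e) (fst e)) = 2 * real (card V) - 2"
  proof -
    have "(\<Sum>e\<in>E. R (snd e) (fst e)) = (\<Sum>u\<in>V. \<Sum>w | w \<in> V \<and> adj u w. R w u)"
      unfolding E_def by (simp add: sum_arcs[OF fin])
    also have "\<dots> = (\<Sum>u\<in>V. 2 - c u)"
    proof (intro sum.cong refl)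
      fix u assume "u \<in> V"
      then show "(\<Sum>w | w \<in> V \<and> adj u w. R w u) = 2 - c u"
        using lap[of u u] diag[of u] by simp
    qed
    finally show ?thesis using sum_c by (simp add: sum_subtractf)
  qed
  have S_eq: "S = (\<Sum>u\<in>V. \<Sum>v\<in>V. d u * d v * R u v)"
  proof -
    have "S = (\<Sum>u\<in>V. d u * r u)"
      unfolding S_def E_def d_def by (rule sum_arcs_snd[OF fin sym])
    also have "\<dots> = (\<Sum>u\<in>V. d u * (\<Sum>v\<in>V. d v * R u v))"
      unfolding r_def E_def by (simp add: sum_arcs_fst[OF fin] d_def)
    finally show ?thesis by (simp add: sum_distrib_left mult.assoc)
  qed
  have \<gamma>_trace: "(\<Sum>e\<in>E. \<gamma> e e) = N - real (card V) + 1 + S / (2 * N)"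
  proof -
    have sS: "(\<Sum>e\<in>E. s (fst e)) = S"
      unfolding s_def S_def r_def by (rule sum.swap)
    have tr: "(\<Sum>e\<in>E. \<gamma> e e) = N - (2 * real (card V) - 2) / 2 + S / (2 * N) + S / (2 * N)
        - N * (S / (2 * N\<^sup>2))"
      unfolding \<gamma>_def
      by (simp add: sum.distrib sum_subtractf cardE sS foster flip: sum_divide_distrib S_def)
    have "N * (S / (2 * N\<^sup>2)) = S / (2 * N)"
      using Npos by (simp add: power2_eq_square)
    then show ?thesis unfolding tr by (simp add: diff_divide_distrib)
  qed

  \<comment> \<open>The arcs are listed in the order used by \<open>arc_walk_matrix\<close>, so the
    matrices below have the entries of \<open>p\<close> and \<open>\<gamma>\<close>.\<close>
  define A where "A = sorted_list_of_set E"
  define n where "n = length A"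
  have setA: "set A = E" and distA: "distinct A" using finE by (auto simp: A_def)
  have nN: "real n = N" unfolding n_def using cardE setA distA by (metis distinct_card)
  have AE: "A ! i \<in> E" if "i < n" for i using that setA n_def nth_mem by blast
  have A_inj: "A ! i = A ! j \<longleftrightarrow> i = j" if "i < n" "j < n" for i j
    using that distA by (simp add: n_def nth_eq_iff_index_eq)
  have sumA: "(\<Sum>i<n. h (A ! i)) = (\<Sum>e\<in>E. h e)" for h :: "'a \<times> 'a \<Rightarrow> real"
    by (rule sum.reindex_bij_betw[OF bij_betw_nth]) (auto simp: distA n_def setA)
  define P :: "complex mat" where "P = mat n n (\<lambda>(i, j). of_real (p (A ! i) (A ! j)))"
  define \<Gamma> :: "complex mat" where "\<Gamma> = mat n n (\<lambda>(i, j). of_real (\<gamma> (A ! i) (A ! j)))"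
  have "arc_walk_matrix adj V = P"
    unfolding arc_walk_matrix_def P_def Let_def E_def[symmetric] A_def[symmetric] n_def[symmetric]
    by (intro eq_matI) (auto simp: p_def d_def)
  moreover have "kemeny P = (\<Sum>i<n. \<Gamma> $$ (i, i)) - 1"
  proof (rule kemeny_eq_trace_fundamental_matrix)
    show "P \<in> carrier_mat n n" "\<Gamma> \<in> carrier_mat n n" by (auto simp: P_def \<Gamma>_def)
    show "n > 0" using nN Npos by (intro gr0I) auto
    show "(\<Sum>j<n. P $$ (i, j)) = 1" if "i < n" for i
    proof -
      have "(\<Sum>j<n. P $$ (i, j)) = of_real (\<Sum>j<n. p (A ! i) (A ! j))"
        using that by (simp add: P_def)
      then show ?thesis using sumA[of "p (A ! i)"] p_row[OF AE[OF that]] by simp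
    qed
    show "(1\<^sub>m n - P + mat n n (\<lambda>_. 1 / of_nat n)) * \<Gamma> = 1\<^sub>m n"
    proof (intro eq_matI)
      fix i j assume "i < dim_row (1\<^sub>m n)" "j < dim_col (1\<^sub>m n)"
      then have ij: "i < n" "j < n" by auto
      have "((1\<^sub>m n - P + mat n n (\<lambda>_. 1 / of_nat n)) * \<Gamma>) $$ (i, j)
        = (\<Sum>k<n. of_real (((if A ! i = A ! k then 1 else 0) - p (A ! i) (A ! k) + 1 / N)
            * \<gamma> (A ! k) (A ! j)))"
        using ij by (simp add: scalar_prod_def P_def \<Gamma>_def atLeast0LessThan A_inj nN[symmetric])
          (auto intro!: sum.cong)
      also have "\<dots> = of_real (\<Sum>g\<in>E. ((if A ! i = g then 1 else 0) - p (A ! i) g + 1 / N)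
            * \<gamma> g (A ! j))"
        by (subst sumA[symmetric]) simp
      also have "\<dots> = 1\<^sub>m n $$ (i, j)"
        using \<gamma>_inv[OF AE AE, of i j] ij A_inj by simp
      finally show "((1\<^sub>m n - P + mat n n (\<lambda>_. 1 / of_nat n)) * \<Gamma>) $$ (i, j) = 1\<^sub>m n $$ (i, j)" .
    qed (auto simp: \<Gamma>_def)
  qed
  moreover have "(\<Sum>i<n. \<Gamma> $$ (i, i)) = of_real (\<Sum>e\<in>E. \<gamma> e e)"
    by (simp add: \<Gamma>_def flip: sumA)
  ultimately show ?thesis
    unfolding edge_kemeny_def by (simp add: \<gamma>_trace S_eq)
qed

section \<open>Cycle barbells\<close>

text \<open>Witnesses and \<open>mod\<close> are replaced by linear case distinctions, which makes
  neighbourhoods decidable by automation. The first path edge stands apart because the numbering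
  jumps from 0 to \<open>a\<close>.\<close>

lemma cb_edge_iff:
  assumes "a \<ge> 3" "b \<ge> 3" "k \<ge> 2"
  shows "cb_edge k a b u v \<longleftrightarrow>
    u < a \<and> v = (if u + 1 = a then 0 else u + 1) \<or> u = 0 \<and> v = a
    \<or> a \<le> u \<and> u < a + k - 2 \<and> v = u + 1
    \<or> a + k - 2 \<le> u \<and> u < a + k - 2 + b
      \<and> v = (if u + 1 = a + k - 2 + b then a + k - 2 else u + 1)"
proof -
  have cyc: "(i + 1) mod l = (if i + 1 = l then 0 else i + 1)" if "i < l" for i l :: nat
    using that by auto
  have A: "(\<exists>i<a. u = i \<and> v = (i + 1) mod a) \<longleftrightarrow> u < a \<and> v = (if u + 1 = a then 0 else u + 1)"
    using cyc[of u a] by auto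
  have B: "(\<exists>i<b. u = a + k - 2 + i \<and> v = a + k - 2 + (i + 1) mod b) \<longleftrightarrow>
    a + k - 2 \<le> u \<and> u < a + k - 2 + b \<and> v = (if u + 1 = a + k - 2 + b then a + k - 2 else u + 1)"
    (is "?L \<longleftrightarrow> ?R")
  proof
    assume ?L
    then obtain i where i: "i < b" "u = a + k - 2 + i" "v = a + k - 2 + (i + 1) mod b" by blast
    then show ?R using cyc[of i b] by auto
  next
    assume r: ?R
    then have "u - (a + k - 2) < b" "u = a + k - 2 + (u - (a + k - 2))" by auto
    moreover have "v = a + k - 2 + (u - (a + k - 2) + 1) mod b"
      using cyc[OF calculation(1)] r by auto
    ultimately show ?L by blast
  qed
  have C: "(\<exists>j. j + 1 < k \<and> u = cb_pathv a j \<and> v = cb_pathv a (j + 1)) \<longleftrightarrow>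
    u = 0 \<and> v = a \<or> a \<le> u \<and> u < a + k - 2 \<and> v = u + 1" (is "?L \<longleftrightarrow> ?R")
  proof
    assume ?L
    then show ?R using assms by (auto simp: cb_pathv_def split: if_splits)
  next
    assume r: ?R
    show ?L
    proof (cases "u = 0 \<and> v = a")
      case True
      then show ?thesis using assms by (intro exI[of _ 0]) (auto simp: cb_pathv_def)
    next
      case False
      then show ?thesis using r assms by (intro exI[of _ "u + 1 - a"]) (auto simp: cb_pathv_def)
    qed
  qed
  show ?thesis unfolding cb_edge_def A B C by blast
qed

text \<open>Here \<open>c\<close> is the junction with the second cycle. The case
  \<open>c = a\<close> is \<open>k = 2\<close>, where the path is a single edge and the junctions
  are adjacent.\<close>

lemma cb_neighbours:
  fixes a b k :: nat
  defines "c \<equiv> a + k - 2"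
  assumes "a \<ge> 3" "b \<ge> 3" "k \<ge> 2"
  shows "{w \<in> cb_verts k a b. cb_adj k a b 0 w} = {1, a - 1, a}"
    and "0 < v \<Longrightarrow> v < a \<Longrightarrow> {w \<in> cb_verts k a b. cb_adj k a b v w}
      = {v - 1, if v + 1 = a then 0 else v + 1}"
    and "a \<le> v \<Longrightarrow> v < c \<Longrightarrow> {w \<in> cb_verts k a b. cb_adj k a b v w}
      = {if v = a then 0 else v - 1, v + 1}"
    and "{w \<in> cb_verts k a b. cb_adj k a b c w}
      = {if c = a then 0 else c - 1, c + 1, c + b - 1}"
    and "c < v \<Longrightarrow> v < c + b \<Longrightarrow> {w \<in> cb_verts k a b. cb_adj k a b v w}
      = {v - 1, if v + 1 = c + b then c else v + 1}"
proof -
  have c: "a \<le> c" "a + b + k - 2 = c + b" using assms by auto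
  have adj: "cb_adj k a b u v \<longleftrightarrow>
      u < a \<and> v = (if u + 1 = a then 0 else u + 1) \<or> v < a \<and> u = (if v + 1 = a then 0 else v + 1)
      \<or> u = 0 \<and> v = a \<or> v = 0 \<and> u = a
      \<or> a \<le> u \<and> u < c \<and> v = u + 1 \<or> a \<le> v \<and> v < c \<and> u = v + 1
      \<or> c \<le> u \<and> u < c + b \<and> v = (if u + 1 = c + b then c else u + 1)
      \<or> c \<le> v \<and> v < c + b \<and> u = (if v + 1 = c + b then c else v + 1)" for u v
    unfolding cb_adj_def cb_edge_iff[OF assms(2-4)] c_def by argo
  note simps = cb_verts_def c(2) adj set_eq_iff mem_Collect_eq insert_iff empty_iff
    atLeastLessThan_iff
  note ab = assms(2,3)
  show "{w \<in> cb_verts k a b. cb_adj k a b 0 w} = {1, a - 1, a}"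
    unfolding simps using ab c(1) by auto
  show "{w \<in> cb_verts k a b. cb_adj k a b v w} = {v - 1, if v + 1 = a then 0 else v + 1}"
    if "0 < v" "v < a" unfolding simps using that ab c(1)
    by (intro allI iffI; elim conjE disjE; auto split: if_splits)
  show "{w \<in> cb_verts k a b. cb_adj k a b v w} = {if v = a then 0 else v - 1, v + 1}"
    if "a \<le> v" "v < c" unfolding simps using that ab c(1) 
    by (intro allI iffI; elim conjE disjE; auto split: if_splits)
  show "{w \<in> cb_verts k a b. cb_adj k a b c w} = {if c = a then 0 else c - 1, c + 1, c + b - 1}"
    unfolding simps using ab c(1)
    by (intro allI iffI; elim conjE disjE; auto split: if_splits)
  show "{w \<in> cb_verts k a b. cb_adj k a b v w} = {v - 1, if v + 1 = c + b then c else v + 1}"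
    if "c < v" "v < c + b" unfolding simps using that ab c(1)
    by (intro allI iffI; elim conjE disjE; auto split: if_splits)
qed

text \<open>The two arcs between the points, of lengths \<open>t\<close> and \<open>l - t\<close>,
  are in parallel and give \<open>t * (l - t) / l\<close>. Real arguments allow steps to the
  positions \<open>-1\<close> and \<open>l\<close>.\<close>

definition cycle_resistance :: "real \<Rightarrow> real \<Rightarrow> real \<Rightarrow> real" where
  "cycle_resistance l x y = \<bar>x - y\<bar> - (x - y)\<^sup>2 / l"

text \<open>The assumption keeps the kink at \<open>q\<close> from lying strictly inside the
  stencil, except at its centre, where it produces the point mass.\<close>

lemma abs_diff_second_difference:
  fixes p q :: real
  assumes "p = q \<or> p + 1 \<le> q \<or> q + 1 \<le> p"
  shows "2 * \<bar>p - q\<bar> - \<bar>p - 1 - q\<bar> - \<bar>p + 1 - q\<bar> = - (if p = q then 2 else 0)"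
  using assms by auto

text \<open>The quadratic part contributes the constant \<open>2 / l\<close>, the absolute value the
  point mass.\<close>

lemma cycle_resistance_second_difference:
  assumes "p = q \<or> p + 1 \<le> q \<or> q + 1 \<le> p" "l > 0"
  shows "2 * cycle_resistance l p q - cycle_resistance l (p - 1) q - cycle_resistance l (p + 1) q
    = 2 / l - (if p = q then 2 else 0)"
proof -
  have "(p - 1 - q)\<^sup>2 / l + (p + 1 - q)\<^sup>2 / l - 2 * ((p - q)\<^sup>2 / l) = 2 / l"
    using assms(2) by (simp add: field_simps power2_eq_square)
  then show ?thesis
    using abs_diff_second_difference[OF assms(1)] unfolding cycle_resistance_def by argo
qed

text \<open>Exchanging the two parallel arcs leaves the resistance unchanged. Here and in the next
  lemma this lets the second difference cross the seam of the cycle.\<close>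

lemma cycle_resistance_wrap:
  assumes "0 \<le> q" "q \<le> l" "l > 0"
  shows "cycle_resistance l l q = cycle_resistance l 0 q"
  using assms by (simp add: cycle_resistance_def field_simps power2_eq_square)

lemma cycle_resistance_wrap_minus:
  assumes "0 \<le> q" "q \<le> l - 1" "l > 0"
  shows "cycle_resistance l (-1) q = cycle_resistance l (l - 1) q"
  using assms by (simp add: cycle_resistance_def field_simps power2_eq_square)

lemma cycle_resistance_same [simp]: "cycle_resistance l x x = 0"
  by (simp add: cycle_resistance_def)

lemma cycle_resistance_commute: "cycle_resistance l x y = cycle_resistance l y x"
  by (simp add: cycle_resistance_def abs_minus_commute power2_commute)

section \<open>Sums of distances and cycle resistances\<close>

lemma sum_real_lessThan: "(\<Sum>i<n. real i) = real n * (real n - 1) / 2"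
  by (induction n) (auto simp: field_simps)

lemma sum_real_squares_lessThan:
  "(\<Sum>i<n. (real i)\<^sup>2) = real n * (real n - 1) * (2 * real n - 1) / 6"
  by (induction n) (auto simp: field_simps power2_eq_square)

lemma sum_sum_abs_diff:
  "(\<Sum>i<n. \<Sum>j<n. \<bar>real i - real j\<bar>) = real n * ((real n)\<^sup>2 - 1) / 3"
proof (induction n)
  case (Suc n)
  have r: "(\<Sum>i<n. \<bar>real n - real i\<bar>) = real n * (real n + 1) / 2"
  proof -
    have "(\<Sum>i<n. \<bar>real n - real i\<bar>) = (\<Sum>i<n. real n - real i)"
      by (intro sum.cong) auto
    then show ?thesis by (simp add: sum_subtractf sum_real_lessThan field_simps)
  qed
  have "(\<Sum>i<Suc n. \<Sum>j<Suc n. \<bar>real i - real j\<bar>)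
      = (\<Sum>i<n. \<Sum>j<n. \<bar>real i - real j\<bar>) + 2 * (\<Sum>i<n. \<bar>real n - real i\<bar>)"
    by (simp add: sum.distrib abs_minus_commute)
  then show ?case unfolding Suc r by (simp add: field_simps power2_eq_square)
qed simp

lemma sum_cycle_resistance:
  assumes "n > 0"
  shows "(\<Sum>i<n. cycle_resistance n (real i) 0) = ((real n)\<^sup>2 - 1) / 6"
  using assms unfolding cycle_resistance_def
  by (simp add: sum_subtractf sum_real_lessThan sum_real_squares_lessThan
      flip: sum_divide_distrib) (simp add: field_simps power2_eq_square)

lemma sum_sum_cycle_resistance:
  assumes "n > 0"
  shows "(\<Sum>i<n. \<Sum>j<n. cycle_resistance n (real i) (real j)) = real n * ((real n)\<^sup>2 - 1) / 6"
proof -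
  have "(\<Sum>i<n. \<Sum>j<n. (real i - real j)\<^sup>2)
      = (\<Sum>i<n. \<Sum>j<n. (real i)\<^sup>2 + (real j)\<^sup>2 - 2 * (real i * real j))"
    by (simp add: power2_diff algebra_simps)
  also have "\<dots> = 2 * real n * (\<Sum>i<n. (real i)\<^sup>2) - 2 * (\<Sum>i<n. real i)\<^sup>2"
    by (simp add: sum.distrib sum_subtractf power2_eq_square sum_product
        flip: sum_distrib_left)
  finally have "(\<Sum>i<n. \<Sum>j<n. (real i - real j)\<^sup>2)
      = (real n)\<^sup>2 * ((real n)\<^sup>2 - 1) / 6"
    unfolding sum_real_lessThan sum_real_squares_lessThan
    by (simp add: field_simps power2_eq_square)
  then show ?thesis
    using assms unfolding cycle_resistance_def sum_subtractf
    by (simp add: sum_sum_abs_diff flip: sum_divide_distrib)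
      (simp add: field_simps power2_eq_square)
qed

lemma sum_lessThan_add:
  fixes f :: "nat \<Rightarrow> 'a :: comm_monoid_add"
  shows "(\<Sum>u<m + n. f u) = (\<Sum>u<m. f u) + (\<Sum>u<n. f (m + u))"
  by (induction n) (simp_all add: add.assoc)

section \<open>Resistance function of the barbell and its Laplacian\<close>

locale cycle_barbell =
  fixes k a b :: nat
  assumes a3: "a \<ge> 3" and b3: "b \<ge> 3" and k2: "k \<ge> 2"
begin

definition c :: nat where "c = a + k - 2"

text \<open>The barbell projects onto each of its two cycles and onto its path by collapsing the rest;
  effective resistance is the sum of the resistances of the three projections.\<close>

definition pos_a :: "nat \<Rightarrow> nat" where "pos_a u = (if u < a then u else 0)"
text \<open>Truncated subtraction does the collapsing: everything before \<open>c\<close> goes to 0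
  here, and in \<open>pos_p\<close> the whole first cycle goes to 0, while \<open>min\<close> sends
  the second cycle to \<open>k - 1\<close>.\<close>

definition pos_b :: "nat \<Rightarrow> nat" where "pos_b u = u - c"
definition pos_p :: "nat \<Rightarrow> nat" where "pos_p u = min (u + 1 - a) (k - 1)"

definition resistance :: "nat \<Rightarrow> nat \<Rightarrow> real" where
  "resistance u v = \<bar>real (pos_p u) - real (pos_p v)\<bar>
     + cycle_resistance a (pos_a u) (pos_a v) + cycle_resistance b (pos_b u) (pos_b v)"

abbreviation nbs :: "nat \<Rightarrow> nat set" where
  "nbs v \<equiv> {w. w \<in> cb_verts k a b \<and> cb_adj k a b v w}"

lemma verts_eq: "cb_verts k a b = {..<c + b}"
  using k2 by (auto simp: cb_verts_def c_def)

lemma a_le_c: "a \<le> c" and c_eq: "c + 1 - a = k - 1" "real c = real a + real k - 2"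
  using k2 by (auto simp: c_def)

lemma nbs_0: "nbs 0 = {1, a - 1, a}"
  and nbs_cycle_a: "0 < v \<Longrightarrow> v < a \<Longrightarrow> nbs v = {v - 1, if v + 1 = a then 0 else v + 1}"
  and nbs_path: "a \<le> v \<Longrightarrow> v < c \<Longrightarrow> nbs v = {if v = a then 0 else v - 1, v + 1}"
  and nbs_c: "nbs c = {if c = a then 0 else c - 1, c + 1, c + b - 1}"
  and nbs_cycle_b: "c < v \<Longrightarrow> v < c + b \<Longrightarrow> nbs v = {v - 1, if v + 1 = c + b then c else v + 1}"
  by (fact cb_neighbours[OF a3 b3 k2, folded c_def])+

lemma vertex_cases:
  assumes "v \<in> cb_verts k a b"
  obtains (zero) "v = 0" | (cycle_a) "0 < v" "v < a" | (path) "a \<le> v" "v < c" | (c) "v = c"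
    | (cycle_b) "c < v" "v < c + b"
proof -
  have "v < c + b" using assms by (simp add: verts_eq)
  then have "v = 0 \<or> 0 < v \<and> v < a \<or> a \<le> v \<and> v < c \<or> v = c \<or> c < v \<and> v < c + b"
    by linarith
  then show ?thesis using that by metis
qed

lemma gdeg_eq:
  assumes "v \<in> cb_verts k a b"
  shows "gdeg (cb_adj k a b) (cb_verts k a b) v = 2 + of_bool (v = 0) + of_bool (v = c)"
  using assms
proof (cases rule: vertex_cases)
  case zero
  then show ?thesis unfolding gdeg_def using nbs_0 a3 a_le_c by simp
next
  case cycle_a
  then show ?thesis unfolding gdeg_def using nbs_cycle_a a3 a_le_c by simp
next
  case path
  then show ?thesis unfolding gdeg_def using nbs_path a3 a_le_c by simp
next
  case c
  have "(if c = a then 0 else c - 1) \<notin> {c + 1, c + b - 1}" "c + 1 \<noteq> c + b - 1"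
    using a3 b3 a_le_c by auto
  then have "card {if c = a then 0 else c - 1, c + 1, c + b - 1} = 3"
    unfolding card_3_iff by blast
  then show ?thesis unfolding gdeg_def c nbs_c using a3 a_le_c by simp
next
  case cycle_b
  then show ?thesis unfolding gdeg_def using nbs_cycle_b a3 b3 a_le_c by simp
qed

text \<open>This is the function \<open>c\<close> of hypothesis \<open>lap\<close>: each cycle
  contributes its constant second difference, and each end of the path contributes -1 because the
  path has only a one-sided difference there.\<close>

definition curv :: "nat \<Rightarrow> real" where
  "curv v = (if v < a then 2 / real a else 0) + (if c \<le> v then 2 / real b else 0)
     - (if v = 0 \<or> v = c then 1 else 0)"

lemma nat_trichotomy_real: "real p = real q \<or> real p + 1 \<le> real q \<or> real q + 1 \<le> real p"
  by (cases p q rule: linorder_cases) auto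

text \<open>Away from the junctions all neighbours move the same coordinate by one step each way, so
  a single second difference is needed. At a junction two neighbours move along the cycle and one
  along the path.\<close>

lemma resistance_laplacian:
  assumes v: "v \<in> cb_verts k a b" and x: "x \<in> cb_verts k a b"
  shows "real (gdeg (cb_adj k a b) (cb_verts k a b) v) * resistance v x
    - (\<Sum>w\<in>nbs v. resistance w x) = curv v - (if v = x then 2 else 0)"
proof -
  define A where "A p = cycle_resistance a p (pos_a x)" for p
  define B where "B p = cycle_resistance b p (pos_b x)" for p
  define T where "T p = \<bar>p - real (pos_p x)\<bar>" for p
  have xb: "pos_a x < a" "pos_b x < b" "pos_p x \<le> k - 1"
    using x a3 b3 by (auto simp: pos_a_def pos_b_def pos_p_def verts_eq)
  have res: "resistance u x = T (pos_p u) + A (pos_a u) + B (pos_b u)" for u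
    by (simp add: resistance_def A_def B_def T_def)
  have A2: "2 * A p - A (real p - 1) - A (real p + 1) = 2 / a - (if p = pos_a x then 2 else 0)"
    for p :: nat
    using cycle_resistance_second_difference[OF nat_trichotomy_real[of p "pos_a x"], of a] a3
    by (simp add: A_def)
  have B2: "2 * B p - B (real p - 1) - B (real p + 1) = 2 / b - (if p = pos_b x then 2 else 0)"
    for p :: nat
    using cycle_resistance_second_difference[OF nat_trichotomy_real[of p "pos_b x"], of b] b3
    by (simp add: B_def)
  have T2: "2 * T p - T (real p - 1) - T (real p + 1) = - (if p = pos_p x then 2 else 0)"
    for p :: nat
    using abs_diff_second_difference[OF nat_trichotomy_real[of p "pos_p x"]] by (simp add: T_def)
  have Aw: "A a = A 0" "A (-1) = A (real a - 1)"
    unfolding A_def using xb(1) a3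
    by (auto intro!: cycle_resistance_wrap cycle_resistance_wrap_minus)
  have Bw: "B b = B 0" "B (-1) = B (real b - 1)"
    unfolding B_def using xb(2) b3
    by (auto intro!: cycle_resistance_wrap cycle_resistance_wrap_minus)
  from v show ?thesis
  proof (cases rule: vertex_cases)
    case zero
    have r: "resistance 0 x = T 0 + A 0 + B 0" "resistance 1 x = T 0 + A 1 + B 0"
      "resistance (a - 1) x = T 0 + A (real a - 1) + B 0" "resistance a x = T 1 + A 0 + B 0"
      unfolding res using a3 a_le_c k2
      by (auto simp: pos_a_def pos_b_def pos_p_def of_nat_diff)
    have deg: "real (gdeg (cb_adj k a b) (cb_verts k a b) v) = 3"
      using gdeg_eq[OF v] zero a3 a_le_c by simp
    have "(\<Sum>w\<in>nbs v. resistance w x) = resistance 1 x + resistance (a - 1) x + resistance a x"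
      unfolding zero nbs_0 using a3 by simp
    moreover have "T 0 - T 1 = (if pos_p x = 0 then -1 else 1)" by (simp add: T_def)
    moreover have "2 * A 0 - A (real a - 1) - A 1 = 2 / a - (if pos_a x = 0 then 2 else 0)"
      using A2[of 0] Aw by auto
    \<comment> \<open>Every \<open>x\<close> has position 0 on the first cycle or on the path. If
      exactly one holds, the cycle's point mass and the sign of the path difference combine to the
      same value \<open>2 / a - 1\<close>; if both hold, \<open>x = 0\<close> and a further 2 is
      subtracted.\<close>
    moreover have "x = 0 \<longleftrightarrow> pos_a x = 0 \<and> pos_p x = 0" "pos_a x = 0 \<or> pos_p x = 0"
      using k2 a3 by (auto simp: pos_a_def pos_p_def)
    moreover have "curv v = 2 / a - 1" using zero a3 a_le_c by (simp add: curv_def)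
    ultimately show ?thesis unfolding deg using zero r by (auto simp: r)
  next
    case cycle_a
    define v' where "v' = (if v + 1 = a then 0 else v + 1)"
    have r: "resistance v x = T 0 + A v + B 0" "resistance (v - 1) x = T 0 + A (real v - 1) + B 0"
      "resistance v' x = T 0 + A (real v + 1) + B 0"
      unfolding res v'_def using cycle_a a3 a_le_c k2 Aw
      by (auto simp: pos_a_def pos_b_def pos_p_def of_nat_diff add.commute)
    have deg: "real (gdeg (cb_adj k a b) (cb_verts k a b) v) = 2"
      using gdeg_eq[OF v] cycle_a a3 a_le_c by simp
    have "(\<Sum>w\<in>nbs v. resistance w x) = resistance (v - 1) x + resistance v' x"
      unfolding nbs_cycle_a[OF cycle_a] using a3 cycle_a by (auto simp: v'_def)
    moreover have "v = x \<longleftrightarrow> v = pos_a x" using cycle_a by (auto simp: pos_a_def)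
    moreover have "curv v = 2 / a" using cycle_a a_le_c by (simp add: curv_def)
    ultimately show ?thesis unfolding deg using r A2[of v] by simp
  next
    case path
    define v' where "v' = (if v = a then 0 else v - 1)"
    define p where "p = v + 1 - a"
    have p: "pos_p v = p" "real (pos_p v') = real p - 1" "real (pos_p (v + 1)) = real p + 1"
      using path a3 c_eq(1) by (auto simp: pos_p_def p_def v'_def of_nat_diff)
    have r: "resistance v x = T p + A 0 + B 0" "resistance v' x = T (real p - 1) + A 0 + B 0"
      "resistance (v + 1) x = T (real p + 1) + A 0 + B 0"
      unfolding res p using path a3 by (auto simp: pos_a_def pos_b_def v'_def)
    have deg: "real (gdeg (cb_adj k a b) (cb_verts k a b) v) = 2"
      using gdeg_eq[OF v] path a3 a_le_c by simp
    have "(\<Sum>w\<in>nbs v. resistance w x) = resistance v' x + resistance (v + 1) x"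
      unfolding nbs_path[OF path] using a3 path by (auto simp: v'_def)
    moreover have "v = x \<longleftrightarrow> p = pos_p x" using path a3 c_eq(1) by (auto simp: pos_p_def p_def)
    moreover have "curv v = 0" using path a3 by (simp add: curv_def)
    ultimately show ?thesis unfolding deg using r T2[of p] by simp
  next
    case c
    define v' where "v' = (if c = a then 0 else c - 1)"
    have p: "real (pos_p c) = real k - 1" "real (pos_p v') = real k - 2"
      "real (pos_p (c + 1)) = real k - 1" "real (pos_p (c + b - 1)) = real k - 1"
      using a3 b3 k2 a_le_c c_eq(1) by (auto simp: pos_p_def v'_def of_nat_diff)
    have r: "resistance c x = T (real k - 1) + A 0 + B 0"
      "resistance v' x = T (real k - 2) + A 0 + B 0"
      "resistance (c + 1) x = T (real k - 1) + A 0 + B 1"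
      "resistance (c + b - 1) x = T (real k - 1) + A 0 + B (real b - 1)"
      unfolding res p using a3 b3 a_le_c by (auto simp: pos_a_def pos_b_def v'_def of_nat_diff)
    have deg: "real (gdeg (cb_adj k a b) (cb_verts k a b) v) = 3"
      using gdeg_eq[OF v] c a3 a_le_c by simp
    have "v' \<notin> {c + 1, c + b - 1}" "c + 1 \<noteq> c + b - 1"
      using a3 b3 a_le_c by (auto simp: v'_def)
    then have "(\<Sum>w\<in>nbs v. resistance w x)
        = resistance v' x + resistance (c + 1) x + resistance (c + b - 1) x"
      unfolding c nbs_c v'_def[symmetric] by simp
    \<comment> \<open>Mirror image of the step from 0 to 1 at the other junction; it relies on
      \<open>pos_p x\<close> being at most \<open>k - 1\<close>.\<close>
    moreover have "T (real k - 1) - T (real k - 2) = (if pos_p x = k - 1 then -1 else 1)"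
    proof (cases "pos_p x = k - 1")
      case True
      then show ?thesis using k2 by (simp add: T_def of_nat_diff)
    next
      case False
      then have "real (pos_p x) \<le> real k - 2" using xb(3) k2 by linarith
      then show ?thesis using False by (simp add: T_def)
    qed
    moreover have "2 * B 0 - B (real b - 1) - B 1 = 2 / b - (if pos_b x = 0 then 2 else 0)"
      using B2[of 0] Bw by auto
    moreover have "x = c \<longleftrightarrow> pos_b x = 0 \<and> pos_p x = k - 1" "pos_b x = 0 \<or> pos_p x = k - 1"
      using k2 a3 a_le_c c_eq(1) by (auto simp: pos_b_def pos_p_def)
    moreover have "curv v = 2 / b - 1" using c a3 a_le_c by (simp add: curv_def)
    ultimately show ?thesis unfolding deg using c r by (auto simp: r)
  next
    case cycle_b
    define v' where "v' = (if v + 1 = c + b then c else v + 1)"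
    define p where "p = v - c"
    have p: "pos_b v = p" "real (pos_b (v - 1)) = real p - 1"
      using cycle_b by (auto simp: pos_b_def p_def of_nat_diff)
    have Bv': "B (pos_b v') = B (real p + 1)"
    proof (cases "v + 1 = c + b")
      case True
      then have "real p + 1 = real b" "pos_b v' = 0"
        using cycle_b by (auto simp: p_def v'_def pos_b_def)
      then show ?thesis using Bw by simp
    next
      case False
      then have "real (pos_b v') = real p + 1"
        using cycle_b by (auto simp: p_def v'_def pos_b_def)
      then show ?thesis by simp
    qed
    have "pos_p v = k - 1" "pos_p (v - 1) = k - 1" "pos_p v' = k - 1"
      using cycle_b a_le_c c_eq(1) by (auto simp: pos_p_def v'_def)
    then have r: "resistance v x = T (k - 1) + A 0 + B p"
      "resistance (v - 1) x = T (k - 1) + A 0 + B (real p - 1)"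
      "resistance v' x = T (k - 1) + A 0 + B (real p + 1)"
      unfolding res p Bv' using cycle_b a_le_c by (auto simp: pos_a_def v'_def)
    have deg: "real (gdeg (cb_adj k a b) (cb_verts k a b) v) = 2"
      using gdeg_eq[OF v] cycle_b a3 a_le_c by simp
    have "(\<Sum>w\<in>nbs v. resistance w x) = resistance (v - 1) x + resistance v' x"
      unfolding nbs_cycle_b[OF cycle_b] using b3 cycle_b by (auto simp: v'_def)
    moreover have "v = x \<longleftrightarrow> p = pos_b x" using cycle_b by (auto simp: pos_b_def p_def)
    moreover have "curv v = 2 / b" using cycle_b a3 a_le_c by (simp add: curv_def)
    ultimately show ?thesis unfolding deg using r B2[of p] by simp
  qed
qed

section \<open>Degree-weighted sums of resistances\<close>

abbreviation deg :: "nat \<Rightarrow> real" where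
  "deg v \<equiv> real (gdeg (cb_adj k a b) (cb_verts k a b) v)"

lemma sum_verts_deg:
  "(\<Sum>u\<in>cb_verts k a b. deg u * f u) = 2 * (\<Sum>u<c + b. f u) + f 0 + f c"
proof -
  have "(\<Sum>u\<in>cb_verts k a b. deg u * f u)
      = (\<Sum>u<c + b. 2 * f u + (if u = 0 then f u else 0) + (if u = c then f u else 0))"
    unfolding verts_eq[symmetric] by (intro sum.cong) (auto simp: gdeg_eq algebra_simps)
  then show ?thesis using b3 by (simp add: sum.distrib sum_distrib_left)
qed

lemma sum_verts_split:
  fixes f :: "nat \<Rightarrow> real"
  shows "(\<Sum>u<c + b. f u) = (\<Sum>u<a. f u) + (\<Sum>u<c - a. f (a + u)) + (\<Sum>u<b. f (c + u))"
  using a_le_c sum_lessThan_add[of f c b] sum_lessThan_add[of f a "c - a"] by simp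

text \<open>Push-forward of the degree measure to the first cycle: weight 2 everywhere, plus an atom
  at 0 collecting the \<open>b + k - 2\<close> collapsed vertices and the extra unit of each
  junction.\<close>

lemma sum_deg_pos_a:
  fixes f :: "nat \<Rightarrow> real"
  shows "(\<Sum>u\<in>cb_verts k a b. deg u * f (pos_a u))
    = 2 * (\<Sum>x<a. f x) + 2 * (real b + real k - 1) * f 0"
proof -
  have "(\<Sum>u<a. f (pos_a u)) = (\<Sum>u<a. f u)" by (simp add: pos_a_def)
  moreover have "(\<Sum>u<c - a. f (pos_a (a + u))) = (real k - 2) * f 0"
    using a_le_c c_eq(2) by (simp add: pos_a_def of_nat_diff)
  moreover have "(\<Sum>u<b. f (pos_a (c + u))) = real b * f 0"
    using a_le_c by (simp add: pos_a_def)
  moreover have "pos_a 0 = 0" "pos_a c = 0" using a_le_c by (auto simp: pos_a_def)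
  ultimately show ?thesis
    unfolding sum_verts_deg sum_verts_split by (simp add: algebra_simps)
qed

lemma sum_deg_pos_b:
  fixes f :: "nat \<Rightarrow> real"
  shows "(\<Sum>u\<in>cb_verts k a b. deg u * f (pos_b u))
    = 2 * (\<Sum>x<b. f x) + 2 * (real a + real k - 1) * f 0"
proof -
  have "(\<Sum>u<a. f (pos_b u)) = (\<Sum>u<a. f 0)"
    using a_le_c by (intro sum.cong) (auto simp: pos_b_def)
  moreover have "(\<Sum>u<c - a. f (pos_b (a + u))) = (real k - 2) * f 0"
  proof -
    have "(\<Sum>u<c - a. f (pos_b (a + u))) = (\<Sum>u<c - a. f 0)"
      by (intro sum.cong) (auto simp: pos_b_def)
    then show ?thesis using a_le_c c_eq(2) by (simp add: of_nat_diff)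
  qed
  moreover have "(\<Sum>u<b. f (pos_b (c + u))) = (\<Sum>u<b. f u)" by (simp add: pos_b_def)
  moreover have "pos_b 0 = 0" "pos_b c = 0" by (auto simp: pos_b_def)
  ultimately show ?thesis
    unfolding sum_verts_deg sum_verts_split by (simp add: algebra_simps)
qed

text \<open>Each end of the path carries a full cycle and one extra unit, \<open>2 * a + 1\<close>
  or \<open>2 * b + 1\<close> in total, of which 2 already sits in the uniform sum.\<close>

lemma sum_deg_pos_p:
  fixes f :: "nat \<Rightarrow> real"
  shows "(\<Sum>u\<in>cb_verts k a b. deg u * f (pos_p u))
    = 2 * (\<Sum>t<k. f t) + (2 * real a - 1) * f 0 + (2 * real b - 1) * f (k - 1)"
proof -
  have "(\<Sum>u<a. f (pos_p u)) = (\<Sum>u<a. f 0)"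
    by (intro sum.cong) (auto simp: pos_p_def)
  moreover have "(\<Sum>u<c - a. f (pos_p (a + u))) = (\<Sum>u<k - 2. f (u + 1))"
    by (intro sum.cong) (auto simp: pos_p_def c_def)
  moreover have "(\<Sum>u<b. f (pos_p (c + u))) = (\<Sum>u<b. f (k - 1))"
    using c_eq(1) by (intro sum.cong) (auto simp: pos_p_def)
  moreover have "pos_p 0 = 0" "pos_p c = k - 1" using a3 c_eq(1) by (auto simp: pos_p_def)
  moreover have "(\<Sum>t<k. f t) = f 0 + (\<Sum>u<k - 2. f (u + 1)) + f (k - 1)"
  proof -
    obtain j where "k = Suc (Suc j)" using k2 by (intro that[of "k - 2"]) simp
    then show ?thesis using sum.lessThan_Suc_shift[of f j] by simp
  qed
  ultimately show ?thesis
    unfolding sum_verts_deg sum_verts_split by (simp add: algebra_simps)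
qed

text \<open>The push-forward is applied once in each variable. With an atom of weight
  \<open>w\<close> at 0 this leaves the uniform double sum and a cross term; the atom paired with
  itself has resistance zero.\<close>

lemma sum_deg_deg_cycle_a:
  "(\<Sum>u\<in>cb_verts k a b. \<Sum>v\<in>cb_verts k a b.
      deg u * deg v * cycle_resistance a (pos_a u) (pos_a v))
    = 2 * ((real a)\<^sup>2 - 1) * (real a + 2 * real b + 2 * real k - 2) / 3" (is "?L = _")
proof -
  define F where "F x = (\<Sum>v\<in>cb_verts k a b. deg v * cycle_resistance a (real x) (pos_a v))" for x
  define w where "w = 2 * (real b + real k - 1)"
  have F: "F x = 2 * (\<Sum>y<a. cycle_resistance a x y) + w * cycle_resistance a x 0" for x
    unfolding F_def w_def using sum_deg_pos_a[of "\<lambda>y. cycle_resistance a (real x) y"] by simp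
  have "?L = (\<Sum>u\<in>cb_verts k a b. deg u * F (pos_a u))"
    by (simp add: F_def sum_distrib_left mult.assoc)
  also have "\<dots> = 2 * (\<Sum>x<a. F x) + w * F 0"
    unfolding sum_deg_pos_a w_def ..
  also have "\<dots> = 4 * (\<Sum>x<a. \<Sum>y<a. cycle_resistance a x y)
      + 4 * w * (\<Sum>x<a. cycle_resistance a x 0)"
    unfolding F by (simp add: sum.distrib cycle_resistance_commute[of _ 0 "real y" for y]
        flip: sum_distrib_left)
  finally show ?thesis
    using a3 by (simp add: sum_cycle_resistance sum_sum_cycle_resistance)
      (simp add: w_def field_simps power2_eq_square)
qed

lemma sum_deg_deg_cycle_b:
  "(\<Sum>u\<in>cb_verts k a b. \<Sum>v\<in>cb_verts k a b.
      deg u * deg v * cycle_resistance b (pos_b u) (pos_b v))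
    = 2 * ((real b)\<^sup>2 - 1) * (real b + 2 * real a + 2 * real k - 2) / 3" (is "?L = _")
proof -
  define F where "F x = (\<Sum>v\<in>cb_verts k a b. deg v * cycle_resistance b (real x) (pos_b v))" for x
  define w where "w = 2 * (real a + real k - 1)"
  have F: "F x = 2 * (\<Sum>y<b. cycle_resistance b x y) + w * cycle_resistance b x 0" for x
    unfolding F_def w_def using sum_deg_pos_b[of "\<lambda>y. cycle_resistance b (real x) y"] by simp
  have "?L = (\<Sum>u\<in>cb_verts k a b. deg u * F (pos_b u))"
    by (simp add: F_def sum_distrib_left mult.assoc)
  also have "\<dots> = 2 * (\<Sum>x<b. F x) + w * F 0"
    unfolding sum_deg_pos_b w_def ..
  also have "\<dots> = 4 * (\<Sum>x<b. \<Sum>y<b. cycle_resistance b x y)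
      + 4 * w * (\<Sum>x<b. cycle_resistance b x 0)"
    unfolding F by (simp add: sum.distrib cycle_resistance_commute[of _ 0 "real y" for y]
        flip: sum_distrib_left)
  finally show ?thesis
    using b3 by (simp add: sum_cycle_resistance sum_sum_cycle_resistance)
      (simp add: w_def field_simps power2_eq_square)
qed

lemma sum_deg_deg_path:
  "(\<Sum>u\<in>cb_verts k a b. \<Sum>v\<in>cb_verts k a b.
      deg u * deg v * \<bar>real (pos_p u) - real (pos_p v)\<bar>)
    = 4 * real k * ((real k)\<^sup>2 - 1) / 3 + 4 * (real a + real b - 1) * real k * (real k - 1)
      + 2 * (2 * real a - 1) * (2 * real b - 1) * (real k - 1)" (is "?L = _")
proof -
  define F where "F x = (\<Sum>v\<in>cb_verts k a b. deg v * \<bar>real x - real (pos_p v)\<bar>)" for x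
  define \<alpha> where "\<alpha> = 2 * real a - 1"
  define \<beta> where "\<beta> = 2 * real b - 1"
  have k1: "real (k - 1) = real k - 1" using k2 by (simp add: of_nat_diff)
  have F: "F x = 2 * (\<Sum>t<k. \<bar>real x - real t\<bar>) + \<alpha> * real x + \<beta> * \<bar>real x - (real k - 1)\<bar>" for x
    unfolding F_def \<alpha>_def \<beta>_def using sum_deg_pos_p[of "\<lambda>y. \<bar>real x - real y\<bar>"] k1 by simp
  have s1: "(\<Sum>t<k. \<bar>real t - (real k - 1)\<bar>) = real k * (real k - 1) / 2"
  proof -
    have "(\<Sum>t<k. \<bar>real t - (real k - 1)\<bar>) = (\<Sum>t<k. (real k - 1) - real t)"
      by (intro sum.cong) auto
    then show ?thesis unfolding sum_subtractf sum_real_lessThan by (simp add: field_simps)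
  qed
  have F0: "F 0 = real k * (real k - 1) + \<beta> * (real k - 1)"
    unfolding F using k2 by (simp add: sum_real_lessThan)
  have F1: "F (k - 1) = real k * (real k - 1) + \<alpha> * (real k - 1)"
    unfolding F k1 using s1 by (simp add: abs_minus_commute)
  have "?L = (\<Sum>u\<in>cb_verts k a b. deg u * F (pos_p u))"
    by (simp add: F_def sum_distrib_left mult.assoc)
  also have "\<dots> = 2 * (\<Sum>x<k. F x) + \<alpha> * F 0 + \<beta> * F (k - 1)"
    unfolding sum_deg_pos_p \<alpha>_def \<beta>_def ..
  also have "(\<Sum>x<k. F x) = 2 * (real k * ((real k)\<^sup>2 - 1) / 3)
      + (\<alpha> + \<beta>) * (real k * (real k - 1) / 2)"
    unfolding F sum.distrib sum_distrib_left[symmetric] sum_sum_abs_diff sum_real_lessThan s1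
    by (simp add: field_simps)
  finally show ?thesis
    unfolding F0 F1 by (simp add: \<alpha>_def \<beta>_def field_simps power2_eq_square)
qed

text \<open>With \<open>k\<close> eliminated in favour of the number of edges \<open>m\<close>, no
  mixed term in \<open>a\<close> and \<open>b\<close> survives, so the cycles can be optimised
  separately.\<close>

lemma sum_deg_deg_resistance:
  defines "m \<equiv> real a + real b + real k - 1"
  shows "(\<Sum>u\<in>cb_verts k a b. \<Sum>v\<in>cb_verts k a b. deg u * deg v * resistance u v)
    = (4 * m ^ 3 + 2 * m) / 3 - (8 * m * (real a)\<^sup>2 - 6 * real a ^ 3 + 4 * m) / 3
      - (8 * m * (real b)\<^sup>2 - 6 * real b ^ 3 + 4 * m) / 3"
  unfolding resistance_def distrib_left sum.distrib
    sum_deg_deg_path sum_deg_deg_cycle_a sum_deg_deg_cycle_b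
  by (simp add: m_def field_simps power2_eq_square power3_eq_cube)

end

lemma Ke_CB_eq:
  assumes "a \<ge> 3" "b \<ge> 3" "k \<ge> 2"
  defines "m \<equiv> real a + real b + real k - 1"
  shows "Ke_CB k a b = of_real (m + 1 + ((4 * m ^ 3 + 2 * m) / 3
    - (8 * m * (real a)\<^sup>2 - 6 * real a ^ 3 + 4 * m) / 3
    - (8 * m * (real b)\<^sup>2 - 6 * real b ^ 3 + 4 * m) / 3) / (4 * m))"
proof -
  interpret cycle_barbell k a b using assms by unfold_locales
  let ?V = "cb_verts k a b"
  have pos: "gdeg (cb_adj k a b) ?V v > 0" if "v \<in> ?V" for v
    using gdeg_eq[OF that] by simp
  have card: "real (card ?V) = m - 1"
    using assms c_eq(2) by (simp add: verts_eq)
  \<comment> \<open>There are \<open>2 * m\<close> arcs and \<open>m - 1\<close> vertices, which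
    yields the summand \<open>m + 1\<close>.\<close>
  have N: "(\<Sum>v\<in>?V. deg v) = 2 * m"
    using sum_verts_deg[of "\<lambda>_. 1"] c_eq(2) by (simp add: m_def)
  have "Ke_CB k a b = of_real ((\<Sum>v\<in>?V. deg v) - real (card ?V)
      + (\<Sum>u\<in>?V. \<Sum>v\<in>?V. deg u * deg v * resistance u v) / (2 * (\<Sum>v\<in>?V. deg v)))"
    unfolding Ke_CB_def
  proof (rule edge_kemeny_eq_resistance_sum)
    show "finite ?V" "?V \<noteq> {}" using b3 by (auto simp: verts_eq lessThan_empty_iff)
    show "cb_adj k a b u v \<longleftrightarrow> cb_adj k a b v u" for u v by (auto simp: cb_adj_def)
    show "resistance v v = 0" for v by (simp add: resistance_def)
  qed (use pos resistance_laplacian in auto)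
  also have "(\<Sum>u\<in>?V. \<Sum>v\<in>?V. deg u * deg v * resistance u v)
    = (4 * m ^ 3 + 2 * m) / 3 - (8 * m * (real a)\<^sup>2 - 6 * real a ^ 3 + 4 * m) / 3
      - (8 * m * (real b)\<^sup>2 - 6 * real b ^ 3 + 4 * m) / 3"
    unfolding m_def by (rule sum_deg_deg_resistance)
  finally show ?thesis unfolding N card by simp
qed

text \<open>The difference of the two sides is divisible by \<open>a - 3\<close>. The cofactor
  increases with \<open>m\<close>, and at the smallest value \<open>m = a + 1\<close> it is visibly
  positive.\<close>

lemma cycle_penalty_ge_triangle:
  fixes a m :: real
  assumes "a \<ge> 3" "m \<ge> a + 1"
  shows "8 * m * 9 - 6 * 27 \<le> 8 * m * a\<^sup>2 - 6 * a ^ 3"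
proof -
  have "0 \<le> 2 * (a * (a - 3)) + 20 * (a - 3) + 30"
    using assms by (intro add_nonneg_nonneg) auto
  also have "\<dots> = 8 * (a + 1) * (a + 3) - 6 * (a\<^sup>2 + 3 * a + 9)"
    by (simp add: power2_eq_square algebra_simps)
  also have "\<dots> \<le> 8 * m * (a + 3) - 6 * (a\<^sup>2 + 3 * a + 9)"
    using assms by (intro diff_right_mono mult_right_mono) auto
  finally have "8 * m * (a + 3) - 6 * (a\<^sup>2 + 3 * a + 9) \<ge> 0" .
  then have "0 \<le> (a - 3) * (8 * m * (a + 3) - 6 * (a\<^sup>2 + 3 * a + 9))" using assms by simp
  also have "\<dots> = 8 * m * a\<^sup>2 - 6 * a ^ 3 - (8 * m * 9 - 6 * 27)"
    by (simp add: power2_eq_square power3_eq_cube algebra_simps)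
  finally show ?thesis by simp
qed

theorem theorem5p6:
  fixes n :: nat
  assumes "n \<ge> 6"
  shows "(\<forall>k a b. a \<ge> 3 \<longrightarrow> b \<ge> 3 \<longrightarrow> k \<ge> 2 \<longrightarrow> a + b + k - 2 = n \<longrightarrow>
            Re (Ke_CB k a b) \<le> Re (Ke_CB (n - 4) 3 3))
       \<and> Ke_CB (n - 4) 3 3 =
           of_real ((2 * real n ^ 3 + 12 * real n ^ 2 - 51 * real n + 101) / (6 * (real n + 1)))"
proof (intro conjI allI impI)
  \<comment> \<open>The number of edges is fixed by \<open>n\<close> and hence common to all
    competing barbells; only the two cycle penalties vary.\<close>
  define m where "m = real n + 1"
  have m: "m > 0" by (simp add: m_def)
  have extremal: "Ke_CB (n - 4) 3 3 = of_real (m + 1 + ((4 * m ^ 3 + 2 * m) / 3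
    - (8 * m * 9 - 6 * 27 + 4 * m) / 3 - (8 * m * 9 - 6 * 27 + 4 * m) / 3) / (4 * m))"
  proof -
    have "real 3 + real 3 + real (n - 4) - 1 = m" using assms by (simp add: m_def of_nat_diff)
    then show ?thesis using Ke_CB_eq[of 3 3 "n - 4"] assms by simp
  qed
  have "m + 1 + ((4 * m ^ 3 + 2 * m) / 3
    - (8 * m * 9 - 6 * 27 + 4 * m) / 3 - (8 * m * 9 - 6 * 27 + 4 * m) / 3) / (4 * m)
    = (2 * m ^ 3 + 6 * m\<^sup>2 - 69 * m + 162) / (6 * m)"
    using m by (simp add: field_simps power2_eq_square power3_eq_cube)
  also have "2 * m ^ 3 + 6 * m\<^sup>2 - 69 * m + 162 = 2 * real n ^ 3 + 12 * real n ^ 2 - 51 * real n + 101"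
    by (simp add: m_def field_simps power2_eq_square power3_eq_cube)
  finally show "Ke_CB (n - 4) 3 3 =
      of_real ((2 * real n ^ 3 + 12 * real n ^ 2 - 51 * real n + 101) / (6 * (real n + 1)))"
    unfolding extremal by (simp add: m_def)
  fix k a b :: nat
  assume ab: "a \<ge> 3" "b \<ge> 3" "k \<ge> 2" and n: "a + b + k - 2 = n"
  have m_eq: "real a + real b + real k - 1 = m" using ab n by (auto simp: m_def)
  have "8 * m * 9 - 6 * 27 \<le> 8 * m * (real a)\<^sup>2 - 6 * real a ^ 3"
    "8 * m * 9 - 6 * 27 \<le> 8 * m * (real b)\<^sup>2 - 6 * real b ^ 3"
    using ab m_eq cycle_penalty_ge_triangle[of "real a" m] cycle_penalty_ge_triangle[of "real b" m]
    by linarith+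
  \<comment> \<open>Isolates the shape of the closed form: \<open>x\<close> and \<open>w\<close>
    depend on \<open>m\<close> alone, so bounding each penalty by its triangle value
    suffices.\<close>
  moreover have aux: "x - (u + w) / 3 - (v + w) / 3 \<le> x - (p + w) / 3 - (p + w) / 3"
    if "p \<le> u" "p \<le> v" for p u v w x :: real
    using that by (simp add: field_simps)
  ultimately show "Re (Ke_CB k a b) \<le> Re (Ke_CB (n - 4) 3 3)"
    unfolding extremal Ke_CB_eq[OF ab] m_eq Re_complex_of_real
    using m by (intro add_left_mono divide_right_mono aux) simp_all
qed

end
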